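(* Let $t,m,s,v$ be positive integers with $t\geq 2$ and $s\leq t\leq ms$. Then $$OCAN(t,m,s,v)\leq \left\lfloor \frac{OCAN(t+1,m,s+1,v)}{v} \right\rfloor.$$
   Context: NRT poset: for positive integers $m,s$, the NRT poset $[m\cdot s]$ is the set $\{1,\ldots,ms\}$ partitioned into $m$ blocks $B_i=\{is+1,\ldots,(i+1)s\}$, $i=0,\ldots,m-1$, where each block is a chain $is+1\preceq is+2\preceq\cdots\preceq (i+1)s$ and elements of different blocks are incomparable. An ideal is a subset $I$ such that $b\in I$ and $a\preceq b$ imply $a\in I$; an anti-ideal is the complement of an ideal. Covering: given an $N\times n$ array over an alphabet $V$ of size $v$, a set of $t$ columns is covered if every $t$-tuple over $V$ occurs at least once as a row of the $N\times t$ subarray formed by those columns. Ordered covering array: for $2\le t\le ms$, an $OCA(N;t,m,s,v)$ is an $N\times ms$ array with entries from an alphabet of size $v$, with columns labeled by $[m\cdot s]$, such that for every anti-ideal $J$ of $[m\cdot s]$ with $|J|=t$ the set of columns labeled by $J$ is covered. $OCAN(t,m,s,v)$ is the smallest positive integer $N$ such that an $OCA(N;t,m,s,v)$ exists. *)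

theory Defs
  imports Complex_Main "HOL-Library.FuncSet"
begin

definition nrt_block :: "nat \<Rightarrow> nat \<Rightarrow> nat set" where
  "nrt_block s i = {i * s + 1..(i + 1) * s}"

definition nrt_carrier :: "nat \<Rightarrow> nat \<Rightarrow> nat set" where
  "nrt_carrier m s = {1..m * s}"

definition nrt_le :: "nat \<Rightarrow> nat \<Rightarrow> nat \<Rightarrow> nat \<Rightarrow> bool" where
  "nrt_le m s a b \<longleftrightarrow> (\<exists>i<m. a \<in> nrt_block s i \<and> b \<in> nrt_block s i \<and> a \<le> b)"

definition nrt_ideal :: "nat \<Rightarrow> nat \<Rightarrow> nat set \<Rightarrow> bool" where
  "nrt_ideal m s I \<longleftrightarrow>
     I \<subseteq> nrt_carrier m s \<and> (\<forall>a b. b \<in> I \<and> nrt_le m s a b \<longrightarrow> a \<in> I)"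

definition nrt_anti_ideal :: "nat \<Rightarrow> nat \<Rightarrow> nat set \<Rightarrow> bool" where
  "nrt_anti_ideal m s J \<longleftrightarrow> (\<exists>I. nrt_ideal m s I \<and> J = nrt_carrier m s - I)"

(* An array with N rows is a function A; its entry in row r < N and column c is A r c.
   A tuple over V whose positions are the columns in J is an element of J \<rightarrow>\<^sub>E V. *)

definition covered :: "(nat \<Rightarrow> nat \<Rightarrow> 'a) \<Rightarrow> nat \<Rightarrow> 'a set \<Rightarrow> nat set \<Rightarrow> bool" where
  "covered A N V J \<longleftrightarrow> (\<forall>x \<in> J \<rightarrow>\<^sub>E V. \<exists>r<N. \<forall>c\<in>J. A r c = x c)"

definition is_OCA ::
  "(nat \<Rightarrow> nat \<Rightarrow> 'a) \<Rightarrow> 'a set \<Rightarrow> nat \<Rightarrow> nat \<Rightarrow> nat \<Rightarrow> nat \<Rightarrow> nat \<Rightarrow> bool" where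
  "is_OCA A V N t m s v \<longleftrightarrow>
     2 \<le> t \<and> t \<le> m * s \<and> finite V \<and> card V = v \<and>
     (\<forall>r<N. \<forall>c\<in>nrt_carrier m s. A r c \<in> V) \<and>
     (\<forall>J. nrt_anti_ideal m s J \<and> card J = t \<longrightarrow> covered A N V J)"

(* Alphabets are finite, so up to renaming of symbols they may be taken to be sets of naturals. *)

definition OCAN :: "nat \<Rightarrow> nat \<Rightarrow> nat \<Rightarrow> nat \<Rightarrow> nat" where
  "OCAN t m s v =
     (LEAST N. 0 < N \<and> (\<exists>(A :: nat \<Rightarrow> nat \<Rightarrow> nat) V. is_OCA A V N t m s v))"

end

theory Submission
  imports Defs
begin

text \<open>
  Fix in an \<open>OCA(N; t + 1, m, s + 1, v)\<close> the maximal column of the first block, and keep only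
  the rows showing its least frequent symbol there, of which there are at most \<open>N / v\<close>. Delete
  that column, and in every other block the minimal column. An anti-ideal of size \<open>t\<close> among the
  remaining columns becomes an anti-ideal of size \<open>t + 1\<close> when the fixed column is added, so all
  its tuples occur in the selected rows.
\<close>

section \<open>Blocks and anti-ideals of the NRT poset\<close>

text \<open>Numbering starts at 1, hence the shift before dividing. The conjunct
  \<open>0 < x\<close> keeps out 0, which truncated subtraction would otherwise place in block
  0.\<close>

lemma nrt_block_iff:
  assumes "0 < s"
  shows "x \<in> nrt_block s i \<longleftrightarrow> 0 < x \<and> (x - 1) div s = i"
proof
  assume "x \<in> nrt_block s i"
  then have "i * s + 1 \<le> x" "x \<le> (i + 1) * s"
    by (auto simp: nrt_block_def)
  then show "0 < x \<and> (x - 1) div s = i"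
    using assms by (auto intro!: div_nat_eqI simp: algebra_simps)
next
  assume x: "0 < x \<and> (x - 1) div s = i"
  then have "x - 1 = i * s + (x - 1) mod s" by (metis div_mult_mod_eq)
  moreover have "(x - 1) mod s < s" using assms by simp
  ultimately show "x \<in> nrt_block s i"
    using x unfolding nrt_block_def atLeastAtMost_iff distrib_right mult_1 by linarith
qed

lemma nrt_block_subset_carrier:
  assumes "i < m"
  shows "nrt_block s i \<subseteq> nrt_carrier m s"
proof -
  have "(i + 1) * s \<le> m * s" using assms by (intro mult_le_mono1) simp
  then show ?thesis by (auto simp: nrt_block_def nrt_carrier_def)
qed

lemma nrt_carrier_blockE:
  assumes "0 < s" and "x \<in> nrt_carrier m s"
  obtains i where "i < m" and "x \<in> nrt_block s i"
proof
  show "x \<in> nrt_block s ((x - 1) div s)"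
    using assms by (auto simp: nrt_block_iff nrt_carrier_def)
  show "(x - 1) div s < m"
    using assms by (auto simp: nrt_carrier_def less_mult_imp_div_less)
qed

text \<open>Complementation turns downward closure into upward closure. Related elements always lie
  in the carrier, so complementing inside it loses nothing.\<close>

lemma nrt_anti_ideal_iff:
  "nrt_anti_ideal m s J \<longleftrightarrow>
     J \<subseteq> nrt_carrier m s \<and> (\<forall>a b. a \<in> J \<and> nrt_le m s a b \<longrightarrow> b \<in> J)"
proof -
  have carrier: "a \<in> nrt_carrier m s \<and> b \<in> nrt_carrier m s" if "nrt_le m s a b" for a b
    using that nrt_block_subset_carrier unfolding nrt_le_def by blast
  show ?thesis
  proof
    assume "nrt_anti_ideal m s J"
    then show "J \<subseteq> nrt_carrier m s \<and> (\<forall>a b. a \<in> J \<and> nrt_le m s a b \<longrightarrow> b \<in> J)"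
      using carrier unfolding nrt_anti_ideal_def nrt_ideal_def by blast
  next
    assume J: "J \<subseteq> nrt_carrier m s \<and> (\<forall>a b. a \<in> J \<and> nrt_le m s a b \<longrightarrow> b \<in> J)"
    then have "nrt_ideal m s (nrt_carrier m s - J)"
      using carrier unfolding nrt_ideal_def by blast
    moreover have "J = nrt_carrier m s - (nrt_carrier m s - J)" using J by blast
    ultimately show "nrt_anti_ideal m s J" unfolding nrt_anti_ideal_def by blast
  qed
qed

lemma nrt_anti_ideal_exists:
  assumes "t \<le> m * s"
  obtains J where "nrt_anti_ideal m s J" and "card J = t"
proof
  \<comment> \<open>The numerically last \<open>t\<close> elements: the NRT order implies the order
    of the naturals, so a final segment is upward closed.\<close>
  let ?J = "{m * s - t + 1..m * s}"
  show "nrt_anti_ideal m s ?J"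
    unfolding nrt_anti_ideal_iff
  proof (intro conjI allI impI)
    show "?J \<subseteq> nrt_carrier m s" by (auto simp: nrt_carrier_def)
    fix a b assume ab: "a \<in> ?J \<and> nrt_le m s a b"
    then have "b \<in> nrt_carrier m s" "a \<le> b"
      using nrt_block_subset_carrier unfolding nrt_le_def by blast+
    with ab show "b \<in> ?J" by (auto simp: nrt_carrier_def)
  qed
  show "card ?J = t" using assms by simp
qed

section \<open>Rows of ordered covering arrays: renumbering, existence and counting\<close>

text \<open>Lets rows be named by any finite set and numbers them afterwards. Below,
  \<open>R\<close> is first a set of functions, then a set of selected row numbers.\<close>

lemma covered_reindex:
  assumes "finite R"
    and cov: "\<And>J x. J \<in> \<J> \<Longrightarrow> x \<in> J \<rightarrow>\<^sub>E V \<Longrightarrow> \<exists>r\<in>R. \<forall>c\<in>J. A r c = x c"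
  obtains h where "h ` {..<card R} = R"
    and "\<And>J. J \<in> \<J> \<Longrightarrow> covered (\<lambda>k. A (h k)) (card R) V J"
proof -
  obtain h where "bij_betw h {0..<card R} R"
    using ex_bij_betw_nat_finite[OF assms(1)] by blast
  then have h: "h ` {..<card R} = R"
    by (simp add: bij_betw_def atLeast0LessThan)
  show thesis
  proof (rule that[OF h])
    fix J assume J: "J \<in> \<J>"
    show "covered (\<lambda>k. A (h k)) (card R) V J"
      unfolding covered_def
    proof
      fix x assume "x \<in> J \<rightarrow>\<^sub>E V"
      then obtain r where r: "r \<in> R" "\<forall>c\<in>J. A r c = x c" using cov[OF J] by blast
      then obtain k where "k < card R" "r = h k" using h by blast
      with r show "\<exists>k<card R. \<forall>c\<in>J. A (h k) c = x c" by blast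
    qed
  qed
qed

text \<open>\<open>is_OCA\<close> does not itself ask for a row, whereas \<open>OCAN\<close>
  minimises over positive numbers. Some anti-ideal of size \<open>t\<close> exists and carries a
  tuple because the alphabet is nonempty; covering that tuple takes a row.\<close>

lemma is_OCA_pos:
  assumes "is_OCA A V N t m s v" and "0 < v"
  shows "0 < N"
proof -
  obtain J where J: "nrt_anti_ideal m s J" "card J = t"
    using nrt_anti_ideal_exists assms(1) unfolding is_OCA_def by blast
  then have "covered A N V J" using assms(1) unfolding is_OCA_def by blast
  moreover obtain e where "e \<in> V"
    using assms unfolding is_OCA_def by (metis card.empty ex_in_conv less_irrefl)
  then have "(\<lambda>c\<in>J. e) \<in> J \<rightarrow>\<^sub>E V" by simp
  ultimately show ?thesis unfolding covered_def by fastforce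
qed

text \<open>The array whose rows are all functions from columns to symbols covers every set of
  columns. This ensures that the minimum defining \<open>OCAN\<close> is attained.\<close>

lemma is_OCA_exists:
  assumes "0 < v" and "2 \<le> t" and "t \<le> m * s"
  obtains A :: "nat \<Rightarrow> nat \<Rightarrow> nat" and V N where "is_OCA A V N t m s v"
proof -
  let ?C = "nrt_carrier m s" and ?V = "{..<v}"
  let ?R = "?C \<rightarrow>\<^sub>E ?V"
  let ?\<J> = "{J. nrt_anti_ideal m s J}"
  have fin: "finite ?R" by (simp add: nrt_carrier_def finite_PiE)
  have cov: "\<exists>r\<in>?R. \<forall>c\<in>J. r c = x c" if "J \<in> ?\<J>" "x \<in> J \<rightarrow>\<^sub>E ?V" for J x
  proof
    have "J \<subseteq> ?C" using that by (simp add: nrt_anti_ideal_iff)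
    \<comment> \<open>A tuple on \<open>J\<close> is extended to all columns by the symbol 0, which
      belongs to the alphabet because \<open>0 < v\<close>.\<close>
    then show "\<forall>c\<in>J. (\<lambda>c\<in>?C. if c \<in> J then x c else 0) c = x c" by auto
    show "(\<lambda>c\<in>?C. if c \<in> J then x c else 0) \<in> ?R"
      using that assms(1) by (fastforce simp: PiE_iff)
  qed
  obtain h where h: "h ` {..<card ?R} = ?R"
    and cov': "\<And>J. J \<in> ?\<J> \<Longrightarrow> covered (\<lambda>k. h k) (card ?R) ?V J"
    using covered_reindex[of ?R ?\<J> ?V "\<lambda>r. r", OF fin cov] by blast
  have "h r c \<in> ?V" if "r < card ?R" "c \<in> ?C" for r c
  proof -
    have "h r \<in> ?R" using h that(1) by blast
    then show ?thesis using that(2) by (rule PiE_mem)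
  qed
  then have "is_OCA h ?V (card ?R) t m s v"
    using assms cov' by (simp add: is_OCA_def)
  then show thesis by (rule that)
qed

lemma OCAN_le:
  fixes A :: "nat \<Rightarrow> nat \<Rightarrow> nat"
  assumes "is_OCA A V N t m s v" and "0 < v"
  shows "OCAN t m s v \<le> N"
  unfolding OCAN_def using assms is_OCA_pos by (intro Least_le) blast

lemma OCAN_attained:
  assumes "0 < v" and "2 \<le> t" and "t \<le> m * s"
  obtains A :: "nat \<Rightarrow> nat \<Rightarrow> nat" and V where "is_OCA A V (OCAN t m s v) t m s v"
proof -
  obtain A :: "nat \<Rightarrow> nat \<Rightarrow> nat" and V N where "is_OCA A V N t m s v"
    using is_OCA_exists[OF assms] by blast
  then have "\<exists>N. 0 < N \<and> (\<exists>(A :: nat \<Rightarrow> nat \<Rightarrow> nat) V. is_OCA A V N t m s v)"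
    using is_OCA_pos assms(1) by blast
  from LeastI_ex[OF this] show thesis using that unfolding OCAN_def by blast
qed

text \<open>Averaging: the fibres of \<open>f\<close> partition the \<open>N\<close> rows, so they
  cannot all be larger than \<open>N / card V\<close>.\<close>

lemma least_frequent_value:
  assumes "finite V" and "V \<noteq> {}" and "\<And>r. r < N \<Longrightarrow> f r \<in> V"
  obtains e where "e \<in> V" and "card {r. r < N \<and> f r = e} * card V \<le> N"
proof -
  have total: "(\<Sum>e\<in>V. card {r. r < N \<and> f r = e}) = N"
    using sum.group[of "{..<N}" V f "\<lambda>_. 1::nat"] assms by (auto simp: image_subset_iff)
  have "\<exists>e\<in>V. card {r. r < N \<and> f r = e} * card V \<le> N"
  proof (rule ccontr)
    assume "\<not> ?thesis"
    then have "(\<Sum>e\<in>V. N) < (\<Sum>e\<in>V. card {r. r < N \<and> f r = e} * card V)"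
      using assms by (intro sum_strict_mono) (auto simp: not_le)
    also have "\<dots> = N * card V" using total by (simp flip: sum_distrib_right)
    finally show False by simp
  qed
  then show thesis using that by blast
qed

section \<open>Embedding the columns of [m \<cdot> s] into those of [m \<cdot> (s + 1)]\<close>

text \<open>
  Sends the elements of the first block to its non-maximal elements in \<open>[m \<cdot> (s + 1)]\<close>,
  and those of any other block to its non-minimal elements.
\<close>

definition nrt_embed :: "nat \<Rightarrow> nat \<Rightarrow> nat" where
  "nrt_embed s c = (if c \<le> s then c else c + (c - 1) div s + 1)"

text \<open>Block \<open>i\<close> starts \<open>i\<close> positions later when the chains have
  length \<open>s + 1\<close>. A shift by \<open>i + 1\<close> therefore skips its minimal element,
  while no shift on block 0 leaves its maximum \<open>s + 1\<close> free.\<close>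

lemma nrt_embed_block:
  assumes "0 < s" and "c \<in> nrt_block s i"
  shows "nrt_embed s c = (if i = 0 then c else c + i + 1)"
    and "nrt_embed s c \<in> nrt_block (s + 1) i"
    and "nrt_embed s c \<noteq> s + 1"
proof -
  have i: "(c - 1) div s = i" using assms by (simp add: nrt_block_iff)
  have c: "i * s + 1 \<le> c" "c \<le> i * s + s" using assms(2) by (auto simp: nrt_block_def)
  have le_iff: "c \<le> s \<longleftrightarrow> i = 0"
  proof (cases i)
    case (Suc k)
    then have "s \<le> i * s" by simp
    with c Suc show ?thesis by simp
  qed (use c in simp)
  then show eq: "nrt_embed s c = (if i = 0 then c else c + i + 1)"
    using i by (simp add: nrt_embed_def)
  show "nrt_embed s c \<in> nrt_block (s + 1) i"
    using c unfolding eq by (auto simp: nrt_block_def algebra_simps)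
  show "nrt_embed s c \<noteq> s + 1"
    using le_iff unfolding eq by (auto split: if_splits)
qed

lemma strict_mono_nrt_embed: "strict_mono (nrt_embed s)"
proof (rule strict_monoI)
  fix a b :: nat assume "a < b"
  moreover from this have "(a - 1) div s \<le> (b - 1) div s" by (intro div_le_mono) simp
  ultimately show "nrt_embed s a < nrt_embed s b" by (auto simp: nrt_embed_def)
qed

text \<open>In block 0 the only element missed by the embedding is the maximum \<open>s + 1\<close>,
  which is inserted. In any other block the missed element is the minimum, which is never above an
  image. So upward closure carries over.\<close>

lemma nrt_anti_ideal_insert_embed:
  assumes "0 < s" and "0 < m" and J: "nrt_anti_ideal m s J"
  shows "nrt_anti_ideal m (s + 1) (insert (s + 1) (nrt_embed s ` J))"
    and "card (insert (s + 1) (nrt_embed s ` J)) = card J + 1"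
proof -
  let ?\<phi> = "nrt_embed s"
  let ?K = "insert (s + 1) (?\<phi> ` J)"
  have J_sub: "J \<subseteq> nrt_carrier m s" and J_up: "\<And>a b. a \<in> J \<Longrightarrow> nrt_le m s a b \<Longrightarrow> b \<in> J"
    using J unfolding nrt_anti_ideal_iff by blast+
  have block: "\<exists>i<m. a \<in> nrt_block s i" if "a \<in> J" for a
    using nrt_carrier_blockE[OF assms(1)] J_sub that by blast
  have top: "s + 1 \<in> nrt_block (s + 1) 0" by (simp add: nrt_block_def)
  have block_unique: "i = j" if "a \<in> nrt_block (s + 1) i" "a \<in> nrt_block (s + 1) j" for a i j
    using that by (simp add: nrt_block_iff del: add_Suc_right)
  show "nrt_anti_ideal m (s + 1) ?K"
    unfolding nrt_anti_ideal_iff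
  proof (intro conjI allI impI)
    have "?\<phi> a \<in> nrt_carrier m (s + 1)" if "a \<in> J" for a
      using block[OF that] nrt_embed_block(2)[OF assms(1)] nrt_block_subset_carrier by blast
    moreover have "s + 1 \<in> nrt_carrier m (s + 1)"
      using top nrt_block_subset_carrier[OF assms(2)] by blast
    ultimately show "?K \<subseteq> nrt_carrier m (s + 1)" by blast
  next
    fix a b assume ab: "a \<in> ?K \<and> nrt_le m (s + 1) a b"
    then obtain i where i: "i < m" "a \<in> nrt_block (s + 1) i" "b \<in> nrt_block (s + 1) i" "a \<le> b"
      unfolding nrt_le_def by blast
    show "b \<in> ?K"
    proof (cases "a = s + 1")
      case True
      then have "i = 0" using block_unique i(2) top by blast
      then have "b = s + 1" using i True by (simp add: nrt_block_def)
      then show ?thesis by simp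
    next
      case False
      then obtain a' where a': "a' \<in> J" "a = ?\<phi> a'" using ab by blast
      obtain j where j: "j < m" "a' \<in> nrt_block s j" using block[OF a'(1)] by blast
      then have "j = i"
        using block_unique nrt_embed_block(2)[OF assms(1)] a'(2) i(2) by blast
      then have a'_block: "a' \<in> nrt_block s i" and a_eq: "a = (if i = 0 then a' else a' + i + 1)"
        using j nrt_embed_block(1)[OF assms(1)] a'(2) by auto
      show ?thesis
      proof (cases "b = s + 1")
        case b_top: False
        \<comment> \<open>Inverts the embedding on block \<open>i\<close>. If \<open>i = 0\<close>,
          excluding \<open>s + 1\<close> leaves \<open>b\<close> in its range; if
          \<open>i > 0\<close>, then \<open>b\<close> lies above the non-minimal \<open>a\<close>
          and is itself non-minimal.\<close>
        define b' where "b' = (if i = 0 then b else b - i - 1)"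
        have b'_block: "b' \<in> nrt_block s i" and "a' \<le> b'" and b_eq: "b = (if i = 0 then b' else b' + i + 1)"
          using a'_block a_eq i(3,4) b_top
          by (auto simp: nrt_block_def b'_def algebra_simps split: if_splits)
        then have "b' \<in> J"
          using J_up[OF a'(1)] a'_block i(1) unfolding nrt_le_def by blast
        moreover have "b = ?\<phi> b'"
          using b_eq nrt_embed_block(1)[OF assms(1) b'_block] by simp
        ultimately show ?thesis by blast
      qed simp
    qed
  qed
  have "s + 1 \<notin> ?\<phi> ` J" using block nrt_embed_block(3)[OF assms(1)] by fastforce
  moreover have "finite J" using J_sub finite_subset by (auto simp: nrt_carrier_def)
  moreover have "card (?\<phi> ` J) = card J"
    using strict_mono_nrt_embed by (intro card_image inj_on_subset[OF strict_mono_imp_inj_on]) auto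
  ultimately show "card ?K = card J + 1" by simp
qed

section \<open>The derived array and the bound\<close>

lemma is_OCA_derived:
  fixes A :: "nat \<Rightarrow> nat \<Rightarrow> 'a"
  assumes "0 < m" and "0 < s" and "0 < v" and "2 \<le> t" and "t \<le> m * s"
    and A: "is_OCA A V N (t + 1) m (s + 1) v"
  obtains A' :: "nat \<Rightarrow> nat \<Rightarrow> 'a" and N' where "is_OCA A' V N' t m s v" and "N' * v \<le> N"
proof -
  let ?\<phi> = "nrt_embed s"
  let ?\<J> = "{J. nrt_anti_ideal m s J \<and> card J = t}"
  have V: "finite V" "card V = v"
    and A_mem: "\<And>r c. r < N \<Longrightarrow> c \<in> nrt_carrier m (s + 1) \<Longrightarrow> A r c \<in> V"
    and A_cov: "\<And>J. nrt_anti_ideal m (s + 1) J \<Longrightarrow> card J = t + 1 \<Longrightarrow> covered A N V J"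
    using A unfolding is_OCA_def by blast+
  have "s + 1 \<in> nrt_carrier m (s + 1)" using assms(1) by (cases m) (auto simp: nrt_carrier_def)
  then have "\<And>r. r < N \<Longrightarrow> A r (s + 1) \<in> V" using A_mem by blast
  moreover have "V \<noteq> {}" using V assms(3) by auto
  ultimately obtain e where e: "e \<in> V"
    and few: "card {r. r < N \<and> A r (s + 1) = e} * card V \<le> N"
    using least_frequent_value[OF V(1), of N "\<lambda>r. A r (s + 1)"] by blast
  define R where "R = {r. r < N \<and> A r (s + 1) = e}"
  have fin: "finite R" by (simp add: R_def)
  have cov: "\<exists>r\<in>R. \<forall>c\<in>J. A r (?\<phi> c) = x c" if J: "J \<in> ?\<J>" and x: "x \<in> J \<rightarrow>\<^sub>E V" for J x
  proof -
    let ?K = "insert (s + 1) (?\<phi> ` J)"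
    have inj: "inj ?\<phi>" by (rule strict_mono_imp_inj_on[OF strict_mono_nrt_embed])
    have notin: "?\<phi> c \<noteq> s + 1" if "c \<in> J" for c
    proof -
      have "c \<in> nrt_carrier m s" using J that by (auto simp: nrt_anti_ideal_iff)
      then show ?thesis
        using nrt_carrier_blockE[OF assms(2)] nrt_embed_block(3)[OF assms(2)] by metis
    qed
    \<comment> \<open>Carries \<open>x\<close> over to the embedded columns and prescribes
      \<open>e\<close> in column \<open>s + 1\<close>, so that any row realising \<open>y\<close>
      automatically lies in \<open>R\<close>.\<close>
    define y where "y = (\<lambda>c\<in>?K. if c = s + 1 then e else x (inv ?\<phi> c))"
    have y: "y (?\<phi> c) = x c" if "c \<in> J" for c
      using that notin inj by (simp add: y_def)
    have "y \<in> ?K \<rightarrow>\<^sub>E V" using x e inj by (auto simp: y_def)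
    moreover have "covered A N V ?K"
    proof (rule A_cov)
      show "nrt_anti_ideal m (s + 1) ?K" "card ?K = t + 1"
        using nrt_anti_ideal_insert_embed[OF assms(2,1)] J by blast+
    qed
    ultimately obtain r where r: "r < N" "\<forall>c\<in>?K. A r c = y c"
      unfolding covered_def by blast
    then have "r \<in> R" by (simp add: R_def y_def)
    moreover have "\<forall>c\<in>J. A r (?\<phi> c) = x c" using r(2) y by simp
    ultimately show ?thesis by blast
  qed
  obtain h where h: "h ` {..<card R} = R"
    and cov': "\<And>J. J \<in> ?\<J> \<Longrightarrow> covered (\<lambda>k c. A (h k) (?\<phi> c)) (card R) V J"
    using covered_reindex[of R ?\<J> V "\<lambda>r c. A r (?\<phi> c)", OF fin cov] by blast
  have A'_mem: "A (h k) (?\<phi> c) \<in> V" if k: "k < card R" and c: "c \<in> nrt_carrier m s" for k c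
  proof (rule A_mem)
    show "h k < N" using h k by (auto simp: R_def)
    obtain i where "i < m" "c \<in> nrt_block s i"
      using nrt_carrier_blockE[OF assms(2) c] .
    then show "?\<phi> c \<in> nrt_carrier m (s + 1)"
      using nrt_embed_block(2)[OF assms(2)] nrt_block_subset_carrier by blast
  qed
  have "is_OCA (\<lambda>k c. A (h k) (?\<phi> c)) V (card R) t m s v"
    unfolding is_OCA_def using assms(4,5) V A'_mem cov' by blast
  moreover have "card R * v \<le> N" using few V by (simp add: R_def)
  ultimately show thesis by (rule that)
qed

theorem proposition6:
  fixes t m s v :: nat
  assumes "0 < m" and "0 < s" and "0 < v"
    and "2 \<le> t" and "s \<le> t" and "t \<le> m * s"
  shows "int (OCAN t m s v) \<le> \<lfloor>real (OCAN (t + 1) m (s + 1) v) / real v\<rfloor>"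
proof -
  let ?N = "OCAN (t + 1) m (s + 1) v"
  \<comment> \<open>Since \<open>m\<close> is at least 1, the larger parameters are admissible, so
    an array of minimal size exists for them.\<close>
  have "t + 1 \<le> m * (s + 1)" using assms by (simp add: algebra_simps)
  then obtain A :: "nat \<Rightarrow> nat \<Rightarrow> nat" and V where "is_OCA A V ?N (t + 1) m (s + 1) v"
    using OCAN_attained[of v "t + 1" m "s + 1"] assms by auto
  then obtain A' :: "nat \<Rightarrow> nat \<Rightarrow> nat" and N'
    where A': "is_OCA A' V N' t m s v" and N': "N' * v \<le> ?N"
    using is_OCA_derived assms by blast
  have "OCAN t m s v * v \<le> N' * v" using OCAN_le[OF A'] assms(3) by simp
  then have "real (OCAN t m s v * v) \<le> real ?N" using N' by linarith
  \<comment> \<open>An integer is at most the floor of a quotient exactly when its product with the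
    positive divisor is at most the dividend.\<close>
  then show ?thesis using assms(3) by (simp add: le_floor_iff pos_le_divide_eq)
qed

end
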